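(* Let $H$ be a cone in $\mathscr{V}_NS$ such that $H=\pi_{\downarrow}(H)$. Let $y\in\mathbb{R}^N$ be a nonzero vector such that the set $$ S_y:=\bigwedge_{S\in H,\ S\ne\{0\}}\frac{S}{S(y)} $$ is absorbing. Let $x_1,\dots,x_n\in\mathbb{R}^N$. Then the inequality $$ \sum_{k=1}^{n}S(x_k)\ \ge\ S(y) $$ holds for every $S\in H$ if and only if there are vectors $z_1,\dots,z_n\in\mathbb{R}^N$ such that $\sum_{k=1}^{n}z_k=y$ and $S(x_k)\ge S(z_k)$ for all $S\in H$ and all $k=1,\dots,n$.
   Context: $\mathscr{V}_N$ is the set of all nonempty compact convex subsets (convex figures) of $\mathbb{R}^N$. A figure $S$ is identified with its support function $S(z)=\sup\{(x,z): x\in S\}$, $z\in\mathbb{R}^N$, where $(\cdot,\cdot)$ is the standard inner product; thus $\mathscr{V}_N$ is a cone (with Minkowski addition and multiplication by nonnegative scalars $tS=\{ts:s\in S\}$) in the space $C(S_{N-1})$ of continuous functions on the Euclidean unit sphere $S_{N-1}$. The meet $\bigwedge$ is intersection. Closedness refers to the Hausdorff metric, i.e. the Chebyshev norm of support functions on $S_{N-1}$. A ball is a symmetric ($S=-S$) absorbing member of $\mathscr{V}_N$. $\mathscr{V}_NS$ is the set of all balls in $\mathbb{R}^N$ together with $\{0\}$; its members are called gauges. The lower hull $\pi_{\downarrow}(H)$ is the least closed cone that lies in $\mathscr{V}_NS$, contains $H$, and is closed under the binary meet (intersection); so $H=\pi_{\downarrow}(H)$ means that $H\subset\mathscr{V}_NS$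 is a closed cone containing the intersection of any two of its members. *)

theory Defs
  imports "HOL-Analysis.Analysis"
begin

definition convex_figures :: "(real ^ 'n) set set" where
  "convex_figures = {S. S \<noteq> {} \<and> compact S \<and> convex S}"

definition support :: "(real ^ 'n) set \<Rightarrow> real ^ 'n \<Rightarrow> real" where
  "support S z = (SUP x\<in>S. x \<bullet> z)"

definition absorbing :: "(real ^ 'n) set \<Rightarrow> bool" where
  "absorbing A \<longleftrightarrow> (\<forall>x. \<exists>r>0. \<forall>t. \<bar>t\<bar> \<le> r \<longrightarrow> t *\<^sub>R x \<in> A)"

definition figure_balls :: "(real ^ 'n) set set" where
  "figure_balls = {S \<in> convex_figures. uminus ` S = S \<and> absorbing S}"

definition gauges :: "(real ^ 'n) set set" where
  "gauges = insert {0} figure_balls"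

text \<open>The Hausdorff metric on convex figures, written as the Chebyshev distance of the
  support functions on the unit sphere. The default value off the convex figures is needed because
  the \<open>Metric_space\<close> locale asks for nonnegativity everywhere.\<close>

definition figure_dist :: "(real ^ 'n) set \<Rightarrow> (real ^ 'n) set \<Rightarrow> real" where
  "figure_dist S T = (if S \<in> convex_figures \<and> T \<in> convex_figures
     then SUP z\<in>sphere 0 1. \<bar>support S z - support T z\<bar> else 0)"

definition figure_topology :: "(real ^ 'n) set topology" where
  "figure_topology = Metric_space.mtopology convex_figures figure_dist"

text \<open>The sum of sets is the Minkowski sum. A cone, being nonempty, contains \<open>{0}\<close>.\<close>

definition figure_cone :: "(real ^ 'n) set set \<Rightarrow> bool" where
  "figure_cone C \<longleftrightarrow> C \<subseteq> convex_figures \<and> C \<noteq> {} \<and>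
     (\<forall>S\<in>C. \<forall>T\<in>C. S + T \<in> C) \<and> (\<forall>S\<in>C. \<forall>t\<ge>0. (*\<^sub>R) t ` S \<in> C)"

text \<open>Closedness of a cone of gauges is taken in the space of gauges. That space is not itself
  closed among all convex figures (balls can degenerate to a segment), so this is the reading
  under which every set of gauges has a lower hull; see \<open>lower_hull_least\<close>. A cone of
  gauges that is closed among all convex figures is in particular closed in this sense.\<close>

definition lower_closed_cone :: "(real ^ 'n) set set \<Rightarrow> bool" where
  "lower_closed_cone C \<longleftrightarrow> figure_cone C \<and> C \<subseteq> gauges \<and>
     closedin (subtopology figure_topology gauges) C \<and> (\<forall>S\<in>C. \<forall>T\<in>C. S \<inter> T \<in> C)"

definition lower_hull :: "(real ^ 'n) set set \<Rightarrow> (real ^ 'n) set set" where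
  "lower_hull H = \<Inter>{C. lower_closed_cone C \<and> H \<subseteq> C}"

definition normalized_meet :: "(real ^ 'n) set set \<Rightarrow> real ^ 'n \<Rightarrow> (real ^ 'n) set" where
  "normalized_meet H y = (\<Inter>S\<in>H - {{0}}. (*\<^sub>R) (1 / support S y) ` S)"

lemma support_bdd:
  assumes "S \<in> convex_figures"
  shows "bdd_above ((\<lambda>x. x \<bullet> z) ` S)"
proof -
  have "compact ((\<lambda>x. x \<bullet> z) ` S)"
    using assms by (intro compact_continuous_image continuous_intros)
      (auto simp: convex_figures_def)
  then show ?thesis by (simp add: bounded_imp_bdd_above compact_imp_bounded)
qed

lemma support_upper: "S \<in> convex_figures \<Longrightarrow> x \<in> S \<Longrightarrow> x \<bullet> z \<le> support S z"
  unfolding support_def by (rule cSUP_upper[OF _ support_bdd])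

lemma support_least:
  assumes "S \<in> convex_figures" "\<And>x. x \<in> S \<Longrightarrow> x \<bullet> z \<le> c"
  shows "support S z \<le> c"
  unfolding support_def using assms by (intro cSUP_least) (auto simp: convex_figures_def)

lemma support_scale:
  assumes "S \<in> convex_figures" "t \<ge> 0"
  shows "support S (t *\<^sub>R z) = t * support S z"
proof (cases "t = 0")
  case True
  then show ?thesis using assms by (simp add: support_def convex_figures_def)
next
  case False
  then have t: "t > 0" using assms by simp
  have "support S z \<le> support S (t *\<^sub>R z) / t"
  proof (rule support_least[OF assms(1)])
    fix x assume "x \<in> S"
    from support_upper[OF assms(1) this, of "t *\<^sub>R z"]
    show "x \<bullet> z \<le> support S (t *\<^sub>R z) / t" using t by (simp add: field_simps)
  qed
  moreover have "support S (t *\<^sub>R z) \<le> t * support S z"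
    using support_upper[OF assms(1)] t by (intro support_least[OF assms(1)]) simp
  ultimately show ?thesis using t by (simp add: field_simps)
qed

lemma support_subset:
  assumes S: "S \<in> convex_figures" and T: "T \<in> convex_figures"
    and le: "\<And>z. z \<in> sphere 0 1 \<Longrightarrow> support S z \<le> support T z"
  shows "S \<subseteq> T"
proof (rule ccontr)
  assume "\<not> S \<subseteq> T"
  then obtain x where x: "x \<in> S" "x \<notin> T" by blast
  have "convex T" "closed T" using T by (auto simp: convex_figures_def compact_imp_closed)
  from separating_hyperplane_closed_point[OF this x(2)]
  obtain a b where ab: "a \<bullet> x < b" "\<forall>u\<in>T. a \<bullet> u > b" by blast
  define z where "z = - a"
  have "T \<noteq> {}" using T by (auto simp: convex_figures_def)
  then have "a \<noteq> 0" using ab by force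
  then have z: "norm z > 0" by (simp add: z_def)
  define w where "w = (1 / norm z) *\<^sub>R z"
  have w: "w \<in> sphere 0 1" using z by (simp add: w_def)
  have zw: "z = norm z *\<^sub>R w" using z by (simp add: w_def)
  have "support S z \<le> support T z"
    using le[OF w] support_scale[OF S, of "norm z" w] support_scale[OF T, of "norm z" w]
    by (metis zw mult_left_mono norm_ge_zero)
  also have "\<dots> \<le> - b"
    using ab by (intro support_least[OF T]) (auto simp: z_def inner_commute less_imp_le)
  also have "\<dots> < x \<bullet> z" using ab by (simp add: z_def inner_commute)
  also have "\<dots> \<le> support S z" by (rule support_upper[OF S x(1)])
  finally show False by simp
qed

lemma support_bounded_sphere:
  assumes "S \<in> convex_figures"
  obtains B where "\<And>z. z \<in> sphere 0 1 \<Longrightarrow> \<bar>support S z\<bar> \<le> B"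
proof -
  from assms obtain B where B: "\<And>x. x \<in> S \<Longrightarrow> norm x \<le> B"
    using compact_imp_bounded bounded_iff by (metis (mono_tags, lifting) convex_figures_def mem_Collect_eq)
  from assms obtain s where s: "s \<in> S" by (auto simp: convex_figures_def)
  have *: "\<bar>x \<bullet> z\<bar> \<le> B" if "x \<in> S" "z \<in> sphere 0 1" for x z
    using Cauchy_Schwarz_ineq2[of x z] B[OF that(1)] that(2) by simp
  have "\<bar>support S z\<bar> \<le> B" if "z \<in> sphere 0 1" for z
  proof -
    have "support S z \<le> B" using *[OF _ that] by (intro support_least[OF assms]) (simp add: abs_le_iff)
    moreover have "- B \<le> support S z"
      using *[OF s that] support_upper[OF assms s, of z] by linarith
    ultimately show ?thesis by linarith
  qed
  with that show ?thesis by blast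
qed

lemma figure_dist_bdd:
  assumes "S \<in> convex_figures" "T \<in> convex_figures"
  shows "bdd_above ((\<lambda>z. \<bar>support S z - support T z\<bar>) ` sphere 0 1)"
proof -
  obtain A where A: "\<And>z. z \<in> sphere 0 1 \<Longrightarrow> \<bar>support S z\<bar> \<le> A"
    using support_bounded_sphere[OF assms(1)] by blast
  obtain B where B: "\<And>z. z \<in> sphere 0 1 \<Longrightarrow> \<bar>support T z\<bar> \<le> B"
    using support_bounded_sphere[OF assms(2)] by blast
  show ?thesis
  proof (rule bdd_aboveI2)
    fix z :: "real ^ 'a" assume "z \<in> sphere 0 1"
    from A[OF this] B[OF this] show "\<bar>support S z - support T z\<bar> \<le> A + B" by linarith
  qed
qed

lemma sphere_nonempty: "sphere (0 :: real ^ 'n) 1 \<noteq> {}"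
  by simp

lemma figure_dist_upper:
  assumes "S \<in> convex_figures" "T \<in> convex_figures" "z \<in> sphere 0 1"
  shows "\<bar>support S z - support T z\<bar> \<le> figure_dist S T"
  using cSUP_upper[OF assms(3) figure_dist_bdd[OF assms(1,2)]] assms by (simp add: figure_dist_def)

lemma Metric_space_figures: "Metric_space convex_figures figure_dist"
proof
  show "0 \<le> figure_dist S T" for S T :: "(real ^ 'n) set"
  proof (cases "S \<in> convex_figures \<and> T \<in> convex_figures")
    case True
    obtain z :: "real ^ 'n" where "z \<in> sphere 0 1" using sphere_nonempty by blast
    with True figure_dist_upper[of S T z] show ?thesis by linarith
  qed (auto simp: figure_dist_def)
  show "figure_dist S T = figure_dist T S" for S T :: "(real ^ 'n) set"
    by (simp add: figure_dist_def abs_minus_commute conj_commute)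
  show "figure_dist S U \<le> figure_dist S T + figure_dist T U"
    if "S \<in> convex_figures" "T \<in> convex_figures" "U \<in> convex_figures"
    for S T U :: "(real ^ 'n) set"
  proof -
    have "(SUP z\<in>sphere 0 1. \<bar>support S z - support U z\<bar>) \<le> figure_dist S T + figure_dist T U"
    proof (rule cSUP_least[OF sphere_nonempty])
      fix z :: "real ^ 'n" assume "z \<in> sphere 0 1"
      from figure_dist_upper[OF that(1,2) this] figure_dist_upper[OF that(2,3) this]
      show "\<bar>support S z - support U z\<bar> \<le> figure_dist S T + figure_dist T U" by linarith
    qed
    with that show ?thesis by (simp add: figure_dist_def[of S U])
  qed
  show "figure_dist S T = 0 \<longleftrightarrow> S = T"
    if "S \<in> convex_figures" "T \<in> convex_figures" for S T :: "(real ^ 'n) set"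
  proof
    assume "figure_dist S T = 0"
    then have "\<And>z. z \<in> sphere 0 1 \<Longrightarrow> support S z = support T z"
      using figure_dist_upper[OF that] by fastforce
    then show "S = T"
      using support_subset[OF that] support_subset[OF that(2,1)] by (metis order.refl subset_antisym)
  next
    assume "S = T"
    then have "\<And>z. z \<in> sphere 0 1 \<Longrightarrow> \<bar>support S z - support T z\<bar> = 0" by simp
    then have "(SUP z\<in>sphere 0 1. \<bar>support S z - support T z\<bar>) = (SUP z\<in>sphere (0 :: real ^ 'n) 1. 0)"
      by (intro SUP_cong) auto
    then show "figure_dist S T = 0" by (simp add: figure_dist_def)
  qed
qed

lemma gauges_iff:
  "S \<in> gauges \<longleftrightarrow> S \<in> convex_figures \<and> uminus ` S = S \<and> (S = {0} \<or> absorbing S)"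
  by (auto simp: gauges_def figure_balls_def convex_figures_def)

lemma absorbing_mono: "absorbing A \<Longrightarrow> A \<subseteq> B \<Longrightarrow> absorbing B"
  unfolding absorbing_def by (meson subsetD)

lemma absorbing_scale:
  assumes "absorbing A" "t > 0"
  shows "absorbing ((*\<^sub>R) t ` A)"
  unfolding absorbing_def
proof
  fix x
  obtain r where r: "r > 0" "\<And>s. \<bar>s\<bar> \<le> r \<Longrightarrow> s *\<^sub>R x \<in> A"
    using assms(1) unfolding absorbing_def by blast
  have "s *\<^sub>R x \<in> (*\<^sub>R) t ` A" if "\<bar>s\<bar> \<le> r * t" for s
  proof
    show "(s / t) *\<^sub>R x \<in> A" using that assms(2) by (intro r) (simp add: field_simps)
    show "s *\<^sub>R x = t *\<^sub>R (s / t) *\<^sub>R x" using assms(2) by simp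
  qed
  then show "\<exists>r>0. \<forall>s. \<bar>s\<bar> \<le> r \<longrightarrow> s *\<^sub>R x \<in> (*\<^sub>R) t ` A"
    using r(1) assms(2) by (intro exI[of _ "r * t"]) simp
qed

lemma absorbing_Int:
  assumes "absorbing A" "absorbing B"
  shows "absorbing (A \<inter> B)"
  unfolding absorbing_def
proof
  fix x
  obtain r where r: "r > 0" "\<And>s. \<bar>s\<bar> \<le> r \<Longrightarrow> s *\<^sub>R x \<in> A"
    using assms(1) unfolding absorbing_def by blast
  obtain q where q: "q > 0" "\<And>s. \<bar>s\<bar> \<le> q \<Longrightarrow> s *\<^sub>R x \<in> B"
    using assms(2) unfolding absorbing_def by blast
  show "\<exists>r>0. \<forall>t. \<bar>t\<bar> \<le> r \<longrightarrow> t *\<^sub>R x \<in> A \<inter> B"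
    using r q by (intro exI[of _ "min r q"]) simp
qed

lemma gauge_zero_mem:
  assumes "S \<in> gauges" shows "0 \<in> S"
proof (cases "S = {0}")
  case False
  then have "absorbing S" using assms by (simp add: gauges_iff)
  then obtain r where "r > 0" "\<And>t. \<bar>t\<bar> \<le> r \<Longrightarrow> t *\<^sub>R 0 \<in> S"
    unfolding absorbing_def by blast
  from this(2)[of 0] \<open>r > 0\<close> show ?thesis by simp
qed simp

lemma gauges_plus:
  assumes "S \<in> gauges" "T \<in> gauges"
  shows "S + T \<in> gauges"
proof -
  have z: "0 \<in> S" "0 \<in> T" using assms by (auto intro: gauge_zero_mem)
  have c: "S \<in> convex_figures" "T \<in> convex_figures"
    and m: "uminus ` S = S" "uminus ` T = T" using assms by (auto simp: gauges_iff)
  have "S + T = {x + y |x y. x \<in> S \<and> y \<in> T}" by (auto simp: set_plus_def)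
  with c have "compact (S + T)" by (simp add: compact_sums convex_figures_def)
  moreover have "convex (S + T)" using c by (auto simp: convex_figures_def intro: convex_set_plus)
  moreover have "S + T \<noteq> {}" using z by (auto simp: set_plus_def)
  ultimately have 1: "S + T \<in> convex_figures" by (simp add: convex_figures_def)
  have mS: "- a \<in> S" if "a \<in> S" for a using m that by blast
  have mT: "- a \<in> T" if "a \<in> T" for a using m that by blast
  have neg: "- c \<in> S + T" if "c \<in> S + T" for c
  proof -
    from that obtain a b where ab: "a \<in> S" "b \<in> T" "c = a + b" by (auto simp: set_plus_def)
    then have "- c = - a + - b" by simp
    with mS[OF ab(1)] mT[OF ab(2)] show ?thesis by (metis set_plus_intro)
  qed
  have 2: "uminus ` (S + T) = S + T"
  proof
    show "uminus ` (S + T) \<subseteq> S + T" using neg by blast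
    show "S + T \<subseteq> uminus ` (S + T)" using neg by (metis add.inverse_inverse image_eqI subsetI)
  qed
  have "S \<subseteq> S + T" "T \<subseteq> S + T"
    using z by (force simp: set_plus_def)+
  then have 3: "absorbing (S + T)" if "absorbing S \<or> absorbing T"
    using that absorbing_mono by blast
  have "S + T = {0}" if "S = {0}" "T = {0}" using that by (auto simp: set_plus_def)
  with 1 2 3 show ?thesis using assms by (auto simp: gauges_iff)
qed

lemma gauges_scale:
  assumes "S \<in> gauges" "t \<ge> 0"
  shows "(*\<^sub>R) t ` S \<in> gauges"
proof -
  have c: "S \<in> convex_figures" and m: "uminus ` S = S" using assms by (auto simp: gauges_iff)
  have 1: "(*\<^sub>R) t ` S \<in> convex_figures"
    using c by (auto simp: convex_figures_def convex_scaling compact_scaling)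
  have "uminus ` (*\<^sub>R) t ` S = (*\<^sub>R) t ` uminus ` S" by (simp add: image_image)
  with m have 2: "uminus ` (*\<^sub>R) t ` S = (*\<^sub>R) t ` S" by simp
  have "(*\<^sub>R) t ` S = {0} \<or> absorbing ((*\<^sub>R) t ` S)"
  proof (cases "t = 0 \<or> S = {0}")
    case True
    then show ?thesis using c by (auto simp: convex_figures_def)
  next
    case False
    then show ?thesis using assms by (auto simp: gauges_iff intro: absorbing_scale)
  qed
  with 1 2 show ?thesis by (simp add: gauges_iff)
qed

lemma gauges_Int:
  assumes "S \<in> gauges" "T \<in> gauges"
  shows "S \<inter> T \<in> gauges"
proof -
  have z: "0 \<in> S" "0 \<in> T" using assms by (auto intro: gauge_zero_mem)
  have m: "uminus ` S = S" "uminus ` T = T" using assms by (auto simp: gauges_iff)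
  have 1: "S \<inter> T \<in> convex_figures"
    using assms z by (auto simp: gauges_iff convex_figures_def compact_Int convex_Int)
  have 2: "uminus ` (S \<inter> T) = S \<inter> T" using m by (simp add: image_Int)
  have "S \<inter> T = {0} \<or> absorbing (S \<inter> T)"
    using assms z by (auto simp: gauges_iff intro: absorbing_Int)
  with 1 2 show ?thesis by (simp add: gauges_iff)
qed

lemma lower_closed_cone_gauges: "lower_closed_cone gauges"
proof -
  have *: "gauges \<subseteq> topspace (figure_topology :: (real ^ 'n) set topology)"
    by (auto simp: figure_topology_def Metric_space.topspace_mtopology[OF Metric_space_figures]
        gauges_iff)
  have "closedin (subtopology figure_topology gauges) (gauges :: (real ^ 'n) set set)"
    using closedin_topspace[of "subtopology figure_topology gauges"] *
    by (simp add: Int_absorb1)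
  then show ?thesis
    unfolding lower_closed_cone_def figure_cone_def
    by (intro conjI ballI allI impI gauges_plus gauges_scale gauges_Int subset_refl)
      (auto simp: gauges_iff, auto simp: gauges_def)
qed

lemma lower_closed_cone_zero:
  assumes "lower_closed_cone C" shows "{0} \<in> C"
proof -
  obtain S where "S \<in> C" using assms by (auto simp: lower_closed_cone_def figure_cone_def)
  then have "(*\<^sub>R) 0 ` S \<in> C" and "S \<in> gauges"
    using assms unfolding lower_closed_cone_def figure_cone_def by blast+
  moreover have "(*\<^sub>R) 0 ` S = {0}" using gauge_zero_mem[OF \<open>S \<in> gauges\<close>] by auto
  ultimately show ?thesis by simp
qed

lemma lower_hull_least:
  assumes "H \<subseteq> gauges"
  shows "lower_closed_cone (lower_hull H)" and "H \<subseteq> lower_hull H"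
    and "lower_closed_cone C \<Longrightarrow> H \<subseteq> C \<Longrightarrow> lower_hull H \<subseteq> C"
proof -
  let ?F = "{C. lower_closed_cone C \<and> H \<subseteq> C}"
  have g: "gauges \<in> ?F" using assms lower_closed_cone_gauges by simp
  have cl: "closedin (subtopology figure_topology gauges) (\<Inter>?F)"
    using g by (intro closedin_Inter) (blast, auto simp: lower_closed_cone_def)
  have ne: "\<Inter>?F \<noteq> {}" using lower_closed_cone_zero by blast
  have sub: "\<Inter>?F \<subseteq> gauges" using g by blast
  have fig: "gauges \<subseteq> convex_figures" by (auto simp: gauges_iff)
  have plus: "S + T \<in> \<Inter>?F" and int: "S \<inter> T \<in> \<Inter>?F" if "S \<in> \<Inter>?F" "T \<in> \<Inter>?F" for S T
    using that by (simp_all add: lower_closed_cone_def figure_cone_def)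
  have scale: "(*\<^sub>R) t ` S \<in> \<Inter>?F" if "S \<in> \<Inter>?F" "t \<ge> 0" for S t
    using that by (simp add: lower_closed_cone_def figure_cone_def)
  have cone: "figure_cone (\<Inter>?F)"
    unfolding figure_cone_def
    by (intro conjI ballI allI impI) (rule order_trans[OF sub fig] ne plus scale; assumption?)+
  show "lower_closed_cone (lower_hull H)"
    unfolding lower_hull_def lower_closed_cone_def[of "\<Inter>?F"]
    by (intro conjI ballI) (rule cone sub cl int; assumption?)+
  show "H \<subseteq> lower_hull H" by (auto simp: lower_hull_def)
  show "lower_closed_cone C \<Longrightarrow> H \<subseteq> C \<Longrightarrow> lower_hull H \<subseteq> C"
    by (auto simp: lower_hull_def)
qed

lemma lower_hull_fixed_iff:
  "H \<subseteq> gauges \<Longrightarrow> H = lower_hull H \<longleftrightarrow> lower_closed_cone H"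
  using lower_hull_least by (metis order.refl subset_antisym)

end

(* For each x let Z(x) be the compact convex set of all z with S(z) <= S(x) on H. Its support
   function at u is the infimum of T(x) over the members T of H containing u, because this infimum is
   sublinear in u. If y lies outside the Minkowski sum of the Z(x_k), a separating vector u yields
   T_k in H containing u with sum_k T_k(x_k) < (u,y). The intersection T of the T_k belongs to H and
   contains u, so T(y) >= (u,y) > sum_k T_k(x_k) >= sum_k T(x_k). *)
theory Submission
  imports Defs
begin

text \<open>A finite-dimensional Hahn-Banach step: a hyperplane separating
  \<open>(u, q u - e)\<close> from the epigraph of \<open>q\<close> is, after normalization, the
  graph of a linear functional below \<open>q\<close>. The slack \<open>e\<close> puts the point
  strictly outside the closed epigraph.\<close>

lemma sublinear_approx_dominated:
  fixes q :: "'a::euclidean_space \<Rightarrow> real"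
  assumes add: "\<And>u v. q (u + v) \<le> q u + q v"
    and scale: "\<And>t u. t \<ge> 0 \<Longrightarrow> q (t *\<^sub>R u) \<le> t * q u"
    and "e > 0"
  obtains z where "\<And>v. v \<bullet> z \<le> q v" and "u \<bullet> z > q u - e"
proof -
  define E where "E = {p. q (fst p) \<le> snd p}"
  have cvx: "convex_on UNIV q"
  proof (rule convex_onI)
    show "q ((1 - t) *\<^sub>R a + t *\<^sub>R b) \<le> (1 - t) * q a + t * q b" if "0 < t" "t < 1" for t a b
      using add[of "(1 - t) *\<^sub>R a" "t *\<^sub>R b"] scale[of "1 - t" a] scale[of t b] that by linarith
  qed simp
  then have cont: "continuous_on UNIV q"
    by (rule convex_on_continuous[OF open_UNIV])
  have "closed E"
    unfolding E_def
    by (intro closed_Collect_le continuous_intros continuous_on_compose2[OF cont]) auto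
  have Esc: "(t *\<^sub>R v, t * r) \<in> E" if "q v \<le> r" "t \<ge> 0" for t v r
    using scale[of t v] mult_left_mono[OF that] that by (auto simp: E_def)
  have "convex E"
  proof (rule convexI)
    fix p p' :: "'a \<times> real" and s t :: real
    assume *: "p \<in> E" "p' \<in> E" "0 \<le> s" "0 \<le> t" "s + t = 1"
    have "q (s *\<^sub>R fst p + t *\<^sub>R fst p') \<le> s * q (fst p) + t * q (fst p')"
      using add[of "s *\<^sub>R fst p" "t *\<^sub>R fst p'"] scale[of s "fst p"] scale[of t "fst p'"] * by linarith
    also have "\<dots> \<le> s * snd p + t * snd p'"
      using * by (intro add_mono mult_left_mono) (auto simp: E_def)
    finally show "s *\<^sub>R p + t *\<^sub>R p' \<in> E" by (simp add: E_def)
  qed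
  have "(u, q u - e) \<notin> E" using \<open>e > 0\<close> by (simp add: E_def)
  from separating_hyperplane_closed_point[OF \<open>convex E\<close> \<open>closed E\<close> this]
  obtain a b c where ac: "a \<bullet> u + b * (q u - e) < c"
    and E: "\<And>v r. (v, r) \<in> E \<Longrightarrow> a \<bullet> v + b * r > c"
    by (force simp: inner_prod_def)
  \<comment> \<open>Scaling by 0 shows that the origin belongs to \<open>E\<close>.\<close>
  have "c < 0" using E[OF Esc[of 0 "q 0" 0]] by simp
  \<comment> \<open>\<open>E\<close> is a cone, so a functional bounded below on it is nonnegative there.\<close>
  have pos: "a \<bullet> v + b * r \<ge> 0" if "q v \<le> r" for v r
  proof (rule ccontr)
    assume "\<not> ?thesis"
    then have neg: "a \<bullet> v + b * r < 0" by simp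
    \<comment> \<open>The multiple of \<open>(v, r)\<close> on which the functional equals
      \<open>c\<close>, against the strict bound.\<close>
    define t where "t = c / (a \<bullet> v + b * r)"
    have "t \<ge> 0" using neg \<open>c < 0\<close> by (simp add: t_def divide_nonpos_neg)
    from E[OF Esc[OF that this]] have "t * (a \<bullet> v + b * r) > c" by (simp add: algebra_simps)
    with neg show False by (simp add: t_def)
  qed
  \<comment> \<open>The functional is nonnegative at \<open>(u, q u)\<close> and negative at
    \<open>(u, q u - e)\<close>, so the hyperplane is not vertical.\<close>
  have "b * e > 0" using pos[of u "q u"] ac \<open>c < 0\<close> by (simp add: algebra_simps)
  then have "b > 0" using \<open>e > 0\<close> by (simp add: zero_less_mult_iff)
  show ?thesis
  proof
    show "v \<bullet> ((- 1 / b) *\<^sub>R a) \<le> q v" for v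
      using pos[of v "q v"] \<open>b > 0\<close> by (simp add: field_simps inner_commute)
    show "u \<bullet> ((- 1 / b) *\<^sub>R a) > q u - e"
      using ac \<open>c < 0\<close> \<open>b > 0\<close> by (simp add: field_simps inner_commute)
  qed
qed

lemma compact_set_sum:
  fixes B :: "'i \<Rightarrow> 'a::real_normed_vector set"
  assumes "\<And>i. i \<in> I \<Longrightarrow> compact (B i)"
  shows "compact (\<Sum>i\<in>I. B i)"
  using assms
proof (induction I rule: infinite_finite_induct)
  case (insert i I)
  have "(\<Sum>i\<in>insert i I. B i) = {x + y | x y. x \<in> B i \<and> y \<in> (\<Sum>i\<in>I. B i)}"
    unfolding sum.insert[OF insert.hyps] by (auto simp: set_plus_def)
  moreover have "compact {x + y | x y. x \<in> B i \<and> y \<in> (\<Sum>i\<in>I. B i)}"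
    using insert by (intro compact_sums) auto
  ultimately show ?case by simp
qed auto

lemma support_mono:
  "S \<in> convex_figures \<Longrightarrow> T \<in> convex_figures \<Longrightarrow> S \<subseteq> T \<Longrightarrow> support S z \<le> support T z"
  by (rule support_least) (auto intro: support_upper)

lemma support_plus_le:
  assumes "S \<in> convex_figures" "T \<in> convex_figures" "S + T \<in> convex_figures"
  shows "support (S + T) z \<le> support S z + support T z"
  using support_upper[OF assms(1)] support_upper[OF assms(2)]
  by (intro support_least[OF assms(3)]) (auto simp: set_plus_def inner_add_left add_mono)

lemma support_image_scale_le:
  assumes "S \<in> convex_figures" "(*\<^sub>R) t ` S \<in> convex_figures" "t \<ge> 0"
  shows "support ((*\<^sub>R) t ` S) z \<le> t * support S z"
  using support_upper[OF assms(1)] assms(3)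
  by (intro support_least[OF assms(2)]) (auto simp: mult_left_mono)

lemma support_add_arg_le:
  "S \<in> convex_figures \<Longrightarrow> support S (v + w) \<le> support S v + support S w"
  by (intro support_least) (auto simp: inner_add_right intro!: add_mono support_upper)

lemma support_sum_arg_le:
  assumes "S \<in> convex_figures" "finite I"
  shows "support S (\<Sum>i\<in>I. z i) \<le> (\<Sum>i\<in>I. support S (z i))"
  using assms(2)
proof induction
  case empty
  then show ?case using support_scale[OF assms(1), of 0 0] by simp
next
  case (insert i I)
  then show ?case using support_add_arg_le[OF assms(1), of "z i" "\<Sum>i\<in>I. z i"] by simp
qed

lemma support_gauge_nonneg: "S \<in> gauges \<Longrightarrow> 0 \<le> support S z"
  using support_upper[of S 0 z] gauge_zero_mem[of S] by (simp add: gauges_iff)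

definition dominated :: "(real ^ 'n) set set \<Rightarrow> real ^ 'n \<Rightarrow> (real ^ 'n) set" where
  "dominated H x = {z. \<forall>S\<in>H. support S z \<le> support S x}"

text \<open>As \<open>support T z\<close> is a supremum over \<open>T\<close>, each bound splits
  into halfspace conditions on \<open>z\<close>; convexity and closedness follow from this
  form.\<close>

lemma dominated_eq:
  assumes "H \<subseteq> convex_figures"
  shows "dominated H x = (\<Inter>T\<in>H. \<Inter>v\<in>T. {z. v \<bullet> z \<le> support T x})"
proof -
  have "support T z \<le> support T x \<longleftrightarrow> (\<forall>v\<in>T. v \<bullet> z \<le> support T x)" if "T \<in> H" for T z
  proof -
    have T: "T \<in> convex_figures" using assms that by auto
    show ?thesis
      using support_upper[OF T, of _ z] support_least[OF T, of z] by (meson order_trans)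
  qed
  then show ?thesis by (auto simp: dominated_def)
qed

lemma convex_dominated: "H \<subseteq> convex_figures \<Longrightarrow> convex (dominated H x)"
  by (simp add: dominated_eq convex_INT convex_halfspace_le)

text \<open>An absorbing \<open>G\<close> contains small multiples, of both signs, of every
  coordinate vector; pairing them with \<open>z\<close> bounds each coordinate of
  \<open>z\<close>.\<close>

lemma compact_dominated:
  fixes H :: "(real ^ 'n) set set"
  assumes "H \<subseteq> convex_figures" "G \<in> H" "absorbing G"
  shows "compact (dominated H x)"
proof -
  have "\<exists>r>0. \<forall>t. \<bar>t\<bar> \<le> r \<longrightarrow> t *\<^sub>R axis i 1 \<in> G" for i
    using assms(3) unfolding absorbing_def by blast
  then obtain r :: "'n \<Rightarrow> real"
    where r: "\<And>i. r i > 0" "\<And>i t. \<bar>t\<bar> \<le> r i \<Longrightarrow> t *\<^sub>R axis i 1 \<in> G"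
    by metis
  let ?c = "\<chi> i. support G x / r i"
  have "dominated H x \<subseteq> cbox (- ?c) ?c"
  proof
    fix z assume z: "z \<in> dominated H x"
    have le: "(t *\<^sub>R axis i 1) \<bullet> z \<le> support G x" if "\<bar>t\<bar> \<le> r i" for i t
      using z r(2)[OF that] assms(1,2) unfolding dominated_eq[OF assms(1)] by blast
    have "- (support G x / r i) \<le> z $ i \<and> z $ i \<le> support G x / r i" for i
      using le[of "r i" i] le[of "- r i" i] r(1)[of i]
      by (simp add: inner_axis' field_simps)
    then show "z \<in> cbox (- ?c) ?c" by (simp add: mem_box_cart)
  qed
  then have "bounded (dominated H x)" using bounded_cbox bounded_subset by blast
  moreover have "closed (dominated H x)"
    using assms(1) by (simp add: dominated_eq closed_INT closed_halfspace_le)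
  ultimately show ?thesis by (simp add: compact_eq_bounded_closed)
qed

text \<open>The formula for the support function of \<open>dominated H x\<close> at
  \<open>u\<close>, up to \<open>e\<close>. Half of \<open>e\<close> pays for the approximate
  functional below \<open>q\<close>, half for a near-minimizer \<open>T\<close>.\<close>

lemma dominated_support_approx:
  fixes H :: "(real ^ 'n) set set"
  assumes cone: "figure_cone H" and gau: "H \<subseteq> gauges" and G: "G \<in> H" "absorbing G" and "e > 0"
  obtains z T where "z \<in> dominated H x" "T \<in> H" "u \<in> T" "support T x < u \<bullet> z + e"
proof -
  have fig: "H \<subseteq> convex_figures"
    and plus: "\<And>S T. S \<in> H \<Longrightarrow> T \<in> H \<Longrightarrow> S + T \<in> H"
    and scale: "\<And>S t. S \<in> H \<Longrightarrow> t \<ge> 0 \<Longrightarrow> (*\<^sub>R) t ` S \<in> H"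
    using cone by (auto simp: figure_cone_def)
  define q where "q v = (INF T\<in>{T\<in>H. v \<in> T}. support T x)" for v
  \<comment> \<open>A large multiple of the absorbing \<open>G\<close> contains \<open>v\<close>, so
    the infimum is over a nonempty set.\<close>
  have ne: "{T\<in>H. v \<in> T} \<noteq> {}" for v
  proof -
    obtain r where r: "r > 0" "\<And>t. \<bar>t\<bar> \<le> r \<Longrightarrow> t *\<^sub>R v \<in> G"
      using G(2) unfolding absorbing_def by blast
    have "v \<in> (*\<^sub>R) (1 / r) ` G" using r(1) r(2)[of r] by (intro image_eqI[of _ _ "r *\<^sub>R v"]) auto
    with scale[OF G(1), of "1 / r"] r(1) show ?thesis by auto
  qed
  have bdd: "bdd_below ((\<lambda>T. support T x) ` {T\<in>H. v \<in> T})" for v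
    using gau support_gauge_nonneg by (intro bdd_belowI2[of _ 0]) blast
  have q_le: "q v \<le> support T x" if "T \<in> H" "v \<in> T" for v T
    unfolding q_def using that by (intro cINF_lower[OF bdd]) simp
  have approx: "\<exists>T\<in>H. v \<in> T \<and> support T x < q v + d" if "d > 0" for v d
    using cINF_less_iff[OF ne bdd, of v "q v + d"] that by (auto simp: q_def[symmetric])
  \<comment> \<open>Minkowski sums of near-minimizers for \<open>v\<close> and \<open>w\<close> are
    competitors for \<open>v + w\<close>.\<close>
  have add: "q (v + w) \<le> q v + q w" for v w
  proof (rule field_le_epsilon)
    fix d :: real assume "d > 0"
    then have d: "d / 2 > 0" by simp
    obtain S where S: "S \<in> H" "v \<in> S" "support S x < q v + d / 2" using approx[OF d] by blast
    obtain T where T: "T \<in> H" "w \<in> T" "support T x < q w + d / 2" using approx[OF d] by blast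
    have "q (v + w) \<le> support (S + T) x"
      using S T by (intro q_le plus) auto
    also have "\<dots> \<le> support S x + support T x"
      using S(1) T(1) plus fig by (intro support_plus_le) auto
    finally show "q (v + w) \<le> q v + q w + d" using S(3) T(3) by linarith
  qed
  have mult: "q (t *\<^sub>R v) \<le> t * q v" if "t \<ge> 0" for t v
  proof (rule field_le_epsilon)
    fix d :: real assume "d > 0"
    \<comment> \<open>The divisor \<open>t + 1\<close> also covers \<open>t = 0\<close>, and
      \<open>t * d / (t + 1)\<close> stays below \<open>d\<close>.\<close>
    then have "d / (t + 1) > 0" using that by simp
    then obtain S where S: "S \<in> H" "v \<in> S" "support S x < q v + d / (t + 1)" using approx by blast
    have "q (t *\<^sub>R v) \<le> support ((*\<^sub>R) t ` S) x"
      using S that by (intro q_le scale) auto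
    also have "\<dots> \<le> t * support S x"
      using S(1) scale fig that by (intro support_image_scale_le) auto
    also have "\<dots> \<le> t * (q v + d / (t + 1))"
      using S(3) that by (intro mult_left_mono) auto
    also have "\<dots> \<le> t * q v + d"
      using that \<open>d > 0\<close> by (simp add: field_simps)
    finally show "q (t *\<^sub>R v) \<le> t * q v + d" .
  qed
  have e: "e / 2 > 0" using \<open>e > 0\<close> by simp
  obtain z where z: "\<And>v. v \<bullet> z \<le> q v" "u \<bullet> z > q u - e / 2"
    using sublinear_approx_dominated[OF add mult e] by blast
  have "z \<in> dominated H x"
    unfolding dominated_eq[OF fig] using z(1) q_le by (blast intro: order_trans)
  moreover obtain T where "T \<in> H" "u \<in> T" "support T x < q u + e / 2"
    using approx[OF e] by blast
  ultimately show ?thesis using that[of z T] z(2) by (simp add: field_simps)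
qed

lemma finite_INT_mem:
  assumes "finite I" "I \<noteq> {}" "\<And>i. i \<in> I \<Longrightarrow> T i \<in> H"
    and "\<And>A B. A \<in> H \<Longrightarrow> B \<in> H \<Longrightarrow> A \<inter> B \<in> H"
  shows "(\<Inter>i\<in>I. T i) \<in> H"
  using assms(1-3) by (induction rule: finite_ne_induct) (auto intro: assms(4))

theorem decomposition_if_support_le:
  fixes H :: "(real ^ 'n) set set"
  assumes H: "lower_closed_cone H" and I: "finite I" "I \<noteq> {}"
    and le: "\<And>S. S \<in> H \<Longrightarrow> support S y \<le> (\<Sum>i\<in>I. support S (x i))"
  obtains z where "sum z I = y" "\<And>i. i \<in> I \<Longrightarrow> z i \<in> dominated H (x i)"
proof (cases "H = {{0}}")
  case True
  \<comment> \<open>All support functions from \<open>H\<close> vanish here, so a single summand may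
    carry all of \<open>y\<close>.\<close>
  obtain j where "j \<in> I" using I by blast
  then have "(\<Sum>i\<in>I. if i = j then y else 0) = y" using I by simp
  moreover have "(if i = j then y else 0) \<in> dominated H (x i)" for i
    by (simp add: dominated_def True support_def)
  ultimately show ?thesis using that by blast
next
  case False
  have cone: "figure_cone H" and gau: "H \<subseteq> gauges"
    and int: "\<And>S T. S \<in> H \<Longrightarrow> T \<in> H \<Longrightarrow> S \<inter> T \<in> H"
    using H by (auto simp: lower_closed_cone_def)
  have fig: "H \<subseteq> convex_figures" using cone by (simp add: figure_cone_def)
  obtain G where G: "G \<in> H" "absorbing G"
  proof -
    obtain S where "S \<in> H" "S \<noteq> {0}" using False lower_closed_cone_zero[OF H] by blast
    moreover from this gau have "absorbing S" by (auto simp: gauges_iff)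
    ultimately show ?thesis using that by blast
  qed
  let ?A = "\<Sum>i\<in>I. dominated H (x i)"
  have "y \<in> ?A"
  proof (rule ccontr)
    assume "y \<notin> ?A"
    have "convex ?A" using fig by (intro convex_set_sum convex_dominated)
    moreover have "closed ?A"
    proof -
      have "compact ?A" using fig G by (intro compact_set_sum compact_dominated)
      then show ?thesis by (rule compact_imp_closed)
    qed
    ultimately obtain a b where ab: "a \<bullet> y < b" "\<forall>v\<in>?A. a \<bullet> v > b"
      using separating_hyperplane_closed_point \<open>y \<notin> ?A\<close> by blast
    \<comment> \<open>The separation gap is shared equally among the indices.\<close>
    define e where "e = (b - a \<bullet> y) / card I"
    have e: "e > 0" "card I * e = b - a \<bullet> y" using ab I by (auto simp: e_def card_gt_0_iff)
    \<comment> \<open>The direction is \<open>- a\<close> because \<open>y\<close> lies on the lower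
      side of the hyperplane.\<close>
    have "\<exists>z T. z \<in> dominated H (x i) \<and> T \<in> H \<and> - a \<in> T \<and> support T (x i) < - a \<bullet> z + e" for i
      using dominated_support_approx[OF cone gau G e(1)] by metis
    then obtain z T where zT: "\<And>i. z i \<in> dominated H (x i)" "\<And>i. T i \<in> H" "\<And>i. - a \<in> T i"
      "\<And>i. support (T i) (x i) < - a \<bullet> z i + e" by metis
    \<comment> \<open>One gauge for all indices: it still contains \<open>- a\<close>, which bounds
      its support at \<open>y\<close> from below, while shrinking to it cannot raise the supports at
      the \<open>x i\<close>.\<close>
    let ?T = "\<Inter>i\<in>I. T i"
    have T: "?T \<in> H" using I zT int by (intro finite_INT_mem) auto
    have "sum z I \<in> ?A" using I zT by (auto simp: set_sum_alt)
    then have b: "a \<bullet> sum z I > b" using ab by blast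
    have "- a \<bullet> y \<le> support ?T y"
      using T fig zT by (intro support_upper) auto
    also have "\<dots> \<le> (\<Sum>i\<in>I. support ?T (x i))" by (rule le[OF T])
    also have "\<dots> \<le> (\<Sum>i\<in>I. support (T i) (x i))"
      using T fig zT by (intro sum_mono support_mono) auto
    also have "\<dots> \<le> (\<Sum>i\<in>I. - a \<bullet> z i + e)"
      using zT by (intro sum_mono less_imp_le)
    also have "\<dots> = - (a \<bullet> sum z I) + card I * e"
      by (simp add: sum.distrib sum_negf inner_sum_right sum_subtractf)
    \<comment> \<open>The errors add up to exactly \<open>b - a \<bullet> y\<close>, so the chain
      gives \<open>a \<bullet> sum z I \<le> b\<close>.\<close>
    finally show False using b e(2) by simp
  qed
  then show ?thesis using that I by (auto simp: set_sum_alt)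
qed

theorem theorem5p1:
  fixes H :: "(real ^ 'N) set set" and y :: "real ^ 'N"
    and n :: nat and x :: "nat \<Rightarrow> real ^ 'N"
  assumes "figure_cone H" and "H \<subseteq> gauges" and "H = lower_hull H"
    and "y \<noteq> 0" and "absorbing (normalized_meet H y)"
    and "n \<ge> 1"
  shows "(\<forall>S\<in>H. (\<Sum>k=1..n. support S (x k)) \<ge> support S y) \<longleftrightarrow>
    (\<exists>z :: nat \<Rightarrow> real ^ 'N. (\<Sum>k=1..n. z k) = y \<and>
       (\<forall>S\<in>H. \<forall>k\<in>{1..n}. support S (x k) \<ge> support S (z k)))"
    (is "?L \<longleftrightarrow> ?R")
proof
  assume L: ?L
  \<comment> \<open>Being its own lower hull makes \<open>H\<close>, in particular, closed under
    binary intersection.\<close>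
  have "lower_closed_cone H" using assms(2,3) lower_hull_fixed_iff by blast
  then obtain z where "(\<Sum>k=1..n. z k) = y" "\<And>k. k \<in> {1..n} \<Longrightarrow> z k \<in> dominated H (x k)"
    using decomposition_if_support_le[of H "{1..n}" y x] L assms(6) by auto
  then show ?R by (auto simp: dominated_def)
next
  assume ?R
  then obtain z where z: "(\<Sum>k=1..n. z k) = y"
    "\<And>S k. S \<in> H \<Longrightarrow> k \<in> {1..n} \<Longrightarrow> support S (z k) \<le> support S (x k)" by blast
  show ?L
  proof
    fix S assume S: "S \<in> H"
    then have "S \<in> convex_figures" using assms(1) by (auto simp: figure_cone_def)
    \<comment> \<open>The converse is subadditivity of the support function along
      \<open>y = z 1 + ... + z n\<close>.\<close>
    from support_sum_arg_le[OF this, of "{1..n}" z] z(1)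
    have "support S y \<le> (\<Sum>k=1..n. support S (z k))" by simp
    also have "\<dots> \<le> (\<Sum>k=1..n. support S (x k))" using z(2)[OF S] by (intro sum_mono)
    finally show "(\<Sum>k=1..n. support S (x k)) \<ge> support S y" .
  qed
qed

end
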